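(* Let $\mu_{\mathrm{TM}}$ be the Thue–Morse measure on $[0,1)$, and let $F(k)=\mu_{\mathrm{TM}}\bigl([0,k]\bigr)$ be its distribution function. Put \[ \alpha=-\frac{\log(\pi^2/2)}{\log 2}\approx-2.302992 . \] Then there exist constants $c_1,c_2>0$ and $k_0>0$ such that, for all $0<k\leqslant k_0$, \[ c_1\,k^{2+\alpha}\exp\Bigl(-\frac{(\log k)^2}{\log 2}\Bigr)\;\leqslant\;F(k)\;\leqslant\;c_2\,k^{\alpha}\exp\Bigl(-\frac{(\log k)^2}{\log 2}\Bigr). \]
   Context: The Thue–Morse measure is the probability measure on $\mathbb{T}=\mathbb{R}/\mathbb{Z}$ (identified with $[0,1)$) given by the infinite Riesz product $\mu_{\mathrm{TM}}=\prod_{\ell=0}^{\infty}\bigl(1-\cos(2^{\ell+1}\pi x)\bigr)$, understood as the vague (weak) limit as $n\to\infty$ of the probability measures with Lebesgue densities $f_n(x)=\prod_{\ell=0}^{n-1}\bigl(1-\cos(2^{\ell+1}\pi x)\bigr)$ on the unit interval. Its distribution function $F$ is continuous on $[0,1]$ with $F(0)=0$ and $F(1)=1$, and is the uniform limit of $F_n(k)=\int_0^k f_n(x)\,dx$. *)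

theory Defs
  imports "HOL-Probability.Probability"
begin

definition riesz_density :: "nat \<Rightarrow> real \<Rightarrow> real" where
  "riesz_density n x = (\<Prod>l<n. 1 - cos (2 ^ (l + 1) * pi * x))"

(* The circle is identified with the unit interval, and measures on it are regarded as Borel
   measures on the real line. *)
definition riesz_measure :: "nat \<Rightarrow> real measure" where
  "riesz_measure n =
     density lborel (\<lambda>x. ennreal (riesz_density n x * indicator {0..<1} x))"

(* Weak limits of probability measures on the line are unique, so this predicate characterises
   a single measure, the infinite Riesz product. That it is concentrated on [0,1) is a
   consequence and not part of the definition. *)
definition is_thue_morse_measure :: "real measure \<Rightarrow> bool" where
  "is_thue_morse_measure \<mu> \<longleftrightarrow>
     real_distribution \<mu> \<and> weak_conv_m riesz_measure \<mu>"

definition tm_alpha :: real where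
  "tm_alpha = - ln (pi\<^sup>2 / 2) / ln 2"

end

theory Submission
  imports Defs
begin

text \<open>
  The densities \<open>f\<^sub>n\<close> satisfy \<open>f\<^bsub>m+n\<^esub>(x) = f\<^sub>m(x) f\<^sub>n(2\<^sup>m x)\<close>. Hence, for
  \<open>k = t / 2\<^sup>m\<close> with \<open>1/2 \<le> t \<le> 1\<close>, \<open>F\<^bsub>m+n\<^esub>(k)\<close> is \<open>2\<^bsup>-m\<^esup>\<close> times the integral over \<open>[0, t]\<close> of
  \<open>f\<^sub>m(y / 2\<^sup>m)\<close> against \<open>f\<^sub>n\<close>. Since \<open>1 - cos \<theta> = 2 sin\<^sup>2(\<theta> / 2)\<close> behaves like \<open>\<theta>\<^sup>2 / 2\<close> for small
  \<open>\<theta>\<close>, the factor \<open>f\<^sub>m(y / 2\<^sup>m)\<close> is at most a constant depending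
  only on \<open>m\<close> times \<open>y\<^bsup>2m\<^esup>\<close>, and for \<open>0 \<le> y \<le> 1\<close> at least a fixed fraction of that. Replacing \<open>y\<close> by \<open>t\<close> gives the upper bound. For the lower bound one integrates
  only over \<open>[t/2, t]\<close>, which carries mass bounded below in \<open>n\<close>; this costs \<open>4\<^bsup>-m\<^esup>\<close>, that is,
  the factor \<open>k\<^sup>2\<close>. Both bounds are uniform in \<open>n\<close> and pass to the weak limit.
\<close>

section \<open>The partial Riesz products\<close>

lemma riesz_density_nonneg: "0 \<le> riesz_density n x"
  by (auto simp: riesz_density_def intro!: prod_nonneg)

lemma continuous_on_riesz_density [continuous_intros]: "continuous_on S (riesz_density n)"
  unfolding riesz_density_def by (intro continuous_intros)

lemma riesz_density_integrable: "riesz_density n integrable_on {a..b}"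
  by (intro integrable_continuous_real continuous_intros)

lemma riesz_density_add:
  "riesz_density (m + n) x = riesz_density m x * riesz_density n (2 ^ m * x)"
  by (induction n) (simp_all add: riesz_density_def power_add ac_simps)

lemma riesz_density_1: "riesz_density 1 x = 1 - cos (2 * pi * x)"
  by (simp add: riesz_density_def)

lemma riesz_density_add_one: "riesz_density n (x + 1) = riesz_density n x"
proof -
  have "cos (2 ^ (l + 1) * pi * (x + 1)) = cos (2 ^ (l + 1) * pi * x)" for l :: nat
    using cos_2npi[of "2 ^ l"] sin_2npi[of "2 ^ l"] by (simp add: distrib_left cos_add)
  then show ?thesis
    by (simp add: riesz_density_def)
qed

lemma riesz_density_minus: "riesz_density n (- x) = riesz_density n x"
  by (simp add: riesz_density_def)

text \<open>Substitution \<open>x = y / 2 ^ m\<close>: the last \<open>n\<close> factors turn into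
  \<open>riesz_density n y\<close>, while the first \<open>m\<close> remain as a weight.\<close>

lemma integral_riesz_density_rescale:
  "integral {a / 2 ^ m..b / 2 ^ m} (riesz_density (m + n)) =
     integral {a..b} (\<lambda>y. riesz_density m (y / 2 ^ m) * riesz_density n y) / 2 ^ m"
  using integral_stretch_real[of "2 ^ m" a b
      "\<lambda>y. riesz_density m (y / 2 ^ m) * riesz_density n y"]
  by (simp add: image_divide_atLeastAtMost riesz_density_add[abs_def])

text \<open>The density is even and has period 1, hence is symmetric about
  \<open>1/2\<close>.\<close>

lemma integral_riesz_density_reflect:
  "integral {1 - b..1 - a} (riesz_density n) = integral {a..b} (riesz_density n)"
proof -
  have "integral {1 - b..1 - a} (riesz_density n) =
      integral {- b..- a} (\<lambda>x. riesz_density n (- x))"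
    using integral_shift_real_ivl[of "1 - b" 1 "1 - a" "riesz_density n"]
    by (simp add: riesz_density_add_one riesz_density_minus)
  also have "\<dots> = integral {a..b} (riesz_density n)"
    by (rule Henstock_Kurzweil_Integration.integral_reflect_real)
  finally show ?thesis .
qed

text \<open>With \<open>y = 2 * x\<close> the first factor becomes \<open>1 - cos (pi * y)\<close>
  on \<open>[0, 2]\<close>. Moving \<open>[1, 2]\<close> onto \<open>[0, 1]\<close> flips the sign
  of the cosine and fixes the other factors, so the cosines cancel.\<close>

lemma integral_riesz_density_unit: "integral {0..1} (riesz_density n) = 1"
proof (induction n)
  case 0
  then show ?case by (simp add: riesz_density_def)
next
  case (Suc n)
  let ?g = "\<lambda>s y. (1 + s * cos (pi * y)) * riesz_density n y"
  have int: "?g s integrable_on {a..b}" for s a b :: real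
    by (intro integrable_continuous_real continuous_intros)
  have shift: "?g (-1) (y + 1) = ?g 1 y" for y
    by (simp add: riesz_density_add_one distrib_left)
  have "integral {0..1} (riesz_density (Suc n)) = integral {0..2} (?g (-1)) / 2"
    using integral_riesz_density_rescale[of 0 1 2 n]
    by (simp add: riesz_density_1[unfolded One_nat_def])
  also have "integral {0..2} (?g (-1)) = integral {0..1} (?g (-1)) + integral {1..2} (?g (-1))"
    by (intro Henstock_Kurzweil_Integration.integral_combine[symmetric] int) auto
  also have "integral {1..2} (?g (-1)) = integral {0..1} (?g 1)"
    using integral_shift_real_ivl[of 1 1 2 "?g (-1)"] unfolding shift by simp
  also have "integral {0..1} (?g (-1)) + integral {0..1} (?g 1) =
      integral {0..1} (\<lambda>y. ?g (-1) y + ?g 1 y)"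
    by (intro Henstock_Kurzweil_Integration.integral_add[symmetric] int)
  also have "(\<lambda>y. ?g (-1) y + ?g 1 y) = (\<lambda>y. 2 * riesz_density n y)"
    by (auto simp: algebra_simps)
  finally show ?case
    using Suc by simp
qed

lemma integral_riesz_density_combine:
  "a \<le> b \<Longrightarrow> b \<le> c \<Longrightarrow> integral {a..c} (riesz_density n) =
     integral {a..b} (riesz_density n) + integral {b..c} (riesz_density n)"
  using riesz_density_integrable
  by (intro Henstock_Kurzweil_Integration.integral_combine[symmetric]) auto

lemma integral_riesz_density_mono:
  assumes "{a..b} \<subseteq> {c..d}"
  shows "integral {a..b} (riesz_density n) \<le> integral {c..d} (riesz_density n)"
  using assms by (intro integral_subset_le riesz_density_integrable)
    (auto simp: riesz_density_nonneg)

text \<open>Only the first \<open>m\<close> factors are estimated; the later ones stay exact, which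
  keeps all bounds uniform in \<open>n\<close>.\<close>

lemma integral_riesz_density_rescale_le:
  assumes "\<And>y. y \<in> {a..b} \<Longrightarrow> riesz_density m (y / 2 ^ m) \<le> C"
  shows "integral {a / 2 ^ m..b / 2 ^ m} (riesz_density (m + n)) \<le>
           C * integral {a..b} (riesz_density n) / 2 ^ m"
proof -
  have "integral {a..b} (\<lambda>y. riesz_density m (y / 2 ^ m) * riesz_density n y) \<le>
      integral {a..b} (\<lambda>y. C * riesz_density n y)"
    using assms
    by (intro integral_le integrable_continuous_real continuous_intros mult_right_mono
        continuous_on_compose2[OF continuous_on_riesz_density[of UNIV]] riesz_density_nonneg) auto
  then show ?thesis
    by (simp add: integral_riesz_density_rescale divide_right_mono)
qed

lemma integral_riesz_density_rescale_ge:
  assumes "\<And>y. y \<in> {a..b} \<Longrightarrow> C \<le> riesz_density m (y / 2 ^ m)"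
  shows "C * integral {a..b} (riesz_density n) / 2 ^ m \<le>
           integral {a / 2 ^ m..b / 2 ^ m} (riesz_density (m + n))"
proof -
  have "integral {a..b} (\<lambda>y. C * riesz_density n y) \<le>
      integral {a..b} (\<lambda>y. riesz_density m (y / 2 ^ m) * riesz_density n y)"
    using assms
    by (intro integral_le integrable_continuous_real continuous_intros mult_right_mono
        continuous_on_compose2[OF continuous_on_riesz_density[of UNIV]] riesz_density_nonneg) auto
  then show ?thesis
    by (simp add: integral_riesz_density_rescale divide_right_mono)
qed

section \<open>Masses of fixed subintervals of the unit interval\<close>

lemma integral_riesz_density_half: "integral {0..1/2} (riesz_density n) = 1 / 2"
  using integral_riesz_density_reflect[of "1/2" 0 n] integral_riesz_density_combine[of 0 "1/2" 1 n]
    integral_riesz_density_unit[of n] by simp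

text \<open>On \<open>[0, 1/4]\<close> the first factor is at most 1, so rescaling gives this
  quarter at most half of the mass \<open>1/2\<close> of \<open>[0, 1/2]\<close>; the rest falls on
  the second quarter.\<close>

lemma integral_riesz_density_second_quarter:
  "1 / 4 \<le> integral {1/4..1/2} (riesz_density (Suc n))"
proof -
  have "0 \<le> cos (pi * y)" if "y \<in> {0..1/2}" for y
    using that by (intro cos_ge_zero) (auto intro: order_trans[of _ 0])
  then have "integral {0..1/4} (riesz_density (Suc n)) \<le> 1 / 4"
    using integral_riesz_density_rescale_le[of 0 "1/2" 1 1 n]
    by (simp add: riesz_density_1[unfolded One_nat_def] integral_riesz_density_half)
  then show ?thesis
    using integral_riesz_density_combine[of 0 "1/4" "1/2" "Suc n"]
      integral_riesz_density_half[of "Suc n"] by simp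
qed

text \<open>The part \<open>[1/8, 1/4]\<close> suffices: doubling carries it to the second quarter,
  of mass at least \<open>1/4\<close>. The first factor is at least \<open>1/4\<close> there, and
  the Jacobian contributes \<open>1/2\<close>.\<close>

lemma integral_riesz_density_first_quarter:
  "1 / 32 \<le> integral {0..1/4} (riesz_density (Suc (Suc n)))"
proof -
  \<comment> \<open>\<open>3/4\<close> is a rational upper bound for
    \<open>cos (pi / 4) = sqrt 2 / 2\<close>.\<close>
  have cos_le: "cos (pi * y) \<le> 3 / 4" if "y \<in> {1/4..1/2}" for y
  proof -
    have "cos (pi * y) \<le> cos (pi * (1/4))"
      using that by (intro cos_monotone_0_pi_le mult_left_mono) auto
    also have "\<dots> = sqrt 2 / 2"
      using cos_45 by simp
    also have "\<dots> \<le> 3 / 4"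
      using real_le_lsqrt[of "3/2" 2] real_sqrt_le_iff[of 2 "(3/2)^2"] by (simp add: power2_eq_square)
    finally show ?thesis .
  qed
  have "1 / 32 \<le> 1 / 4 * integral {1/4..1/2} (riesz_density (Suc n)) / 2"
    using integral_riesz_density_second_quarter[of n] by simp
  also have "\<dots> \<le> integral {1/8..1/4} (riesz_density (Suc (Suc n)))"
  proof -
    have "1 / 4 \<le> riesz_density 1 (y / 2 ^ 1)" if "y \<in> {1/4..1/2}" for y
      using cos_le[OF that] unfolding riesz_density_1 by simp
    then show ?thesis
      using integral_riesz_density_rescale_ge[of "1/4" "1/2" "1/4" 1 "Suc n"] by simp
  qed
  also have "\<dots> \<le> integral {0..1/4} (riesz_density (Suc (Suc n)))"
    by (intro integral_riesz_density_mono) auto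
  finally show ?thesis .
qed

text \<open>The interval always contains \<open>[3/8, 1/2]\<close> or \<open>[1/2, 3/4]\<close>. The
  three extra factors are two for the first-quarter bound and one for a further doubling.\<close>

lemma integral_riesz_density_upper_half:
  assumes "1/2 \<le> t" "t \<le> 1"
  shows "1 / 64 \<le> integral {t/2..t} (riesz_density (n + 3))"
proof (cases "t \<le> 3 / 4")
  case True
  \<comment> \<open>Doubling carries \<open>[3/8, 1/2]\<close> to \<open>[3/4, 1]\<close>, the
    mirror image of the first quarter. There \<open>cos (pi * y) \<le> 0\<close>, so the first
    factor is at least 1.\<close>
  have "1 / 64 \<le> integral {3/4..1} (riesz_density (Suc (Suc n))) / 2"
    using integral_riesz_density_first_quarter[of n]
      integral_riesz_density_reflect[of "1/4" 0 "Suc (Suc n)"] by simp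
  also have "\<dots> \<le> integral {3/8..1/2} (riesz_density (1 + Suc (Suc n)))"
  proof -
    have "cos (pi * y) \<le> 0" if "y \<in> {3/4..1}" for y
    proof -
      have "cos (pi * y) \<le> cos (pi * (1/2))"
        using that by (intro cos_monotone_0_pi_le mult_left_mono) auto
      then show ?thesis by simp
    qed
    then show ?thesis
      using integral_riesz_density_rescale_ge[of "3/4" 1 1 1 "Suc (Suc n)"]
      by (simp add: riesz_density_1[unfolded One_nat_def])
  qed
  also have "\<dots> \<le> integral {t/2..t} (riesz_density (1 + Suc (Suc n)))"
    using assms True by (intro integral_riesz_density_mono) auto
  finally show ?thesis by (simp add: eval_nat_numeral)
next
  case False
  have "1 / 64 \<le> integral {1/4..1/2} (riesz_density (n + 3))"
    using integral_riesz_density_second_quarter[of "n + 2"] by (simp add: eval_nat_numeral)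
  also have "\<dots> = integral {1/2..3/4} (riesz_density (n + 3))"
    using integral_riesz_density_reflect[of "1/2" "1/4" "n + 3"] by simp
  also have "\<dots> \<le> integral {t/2..t} (riesz_density (n + 3))"
    using assms False by (intro integral_riesz_density_mono) auto
  finally show ?thesis .
qed

section \<open>The first factors near the origin\<close>

text \<open>Replacing every factor \<open>1 - cos \<theta>\<close> by its leading term
  \<open>\<theta>\<^sup>2 / 2\<close> turns \<open>riesz_density m (y / 2 ^ m)\<close> into
  \<open>2 ^ m * riesz_scale m * y ^ (2 * m)\<close>. The power \<open>2 ^ m\<close> is split off
  because it cancels against the Jacobian of the rescaling.\<close>

definition riesz_scale :: "nat \<Rightarrow> real" where
  "riesz_scale m = (pi\<^sup>2 / 2) ^ m / 2 ^ (m\<^sup>2)"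

lemma riesz_scale_pos: "0 < riesz_scale m"
  by (simp add: riesz_scale_def)

lemma riesz_scale_Suc: "2 * riesz_scale (Suc m) = 2 * (pi / 2 ^ Suc m)\<^sup>2 * riesz_scale m"
  by (simp add: riesz_scale_def power2_eq_square power_add power_mult_distrib field_simps)

text \<open>Splitting off the lowest frequency doubles the argument of the rest, so inductions on
  \<open>m\<close> can keep \<open>y\<close> fixed.\<close>

lemma riesz_density_Suc_rescale:
  "riesz_density (Suc m) (y / 2 ^ Suc m) =
     2 * (sin (pi * y / 2 ^ Suc m))\<^sup>2 * riesz_density m (y / 2 ^ m)"
  using riesz_density_add[of 1 m "y / 2 ^ Suc m"] cos_double_sin[of "pi * y / 2 ^ Suc m"]
  by (simp add: riesz_density_1[unfolded One_nat_def])

lemma riesz_density_rescale_le: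
  "riesz_density m (y / 2 ^ m) \<le> 2 ^ m * riesz_scale m * y ^ (2 * m)"
proof (induction m)
  case 0
  then show ?case by (simp add: riesz_density_def riesz_scale_def)
next
  case (Suc m)
  have "(sin (pi * y / 2 ^ Suc m))\<^sup>2 \<le> (pi * y / 2 ^ Suc m)\<^sup>2"
    using abs_sin_x_le_abs_x by (simp only: abs_le_square_iff)
  then have "riesz_density (Suc m) (y / 2 ^ Suc m) \<le>
      2 * (pi * y / 2 ^ Suc m)\<^sup>2 * (2 ^ m * riesz_scale m * y ^ (2 * m))"
    unfolding riesz_density_Suc_rescale
    by (intro mult_mono Suc.IH) (auto simp: riesz_density_nonneg)
  also have "\<dots> = (2 * (pi / 2 ^ Suc m)\<^sup>2 * riesz_scale m) * 2 ^ m * y ^ (2 * Suc m)"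
    by (simp add: power_mult_distrib power_divide power_add power2_eq_square ac_simps)
  also have "\<dots> = 2 ^ Suc m * riesz_scale (Suc m) * y ^ (2 * Suc m)"
    unfolding riesz_scale_Suc[symmetric] by simp
  finally show ?case .
qed

lemma sin_ge_cubic:
  fixes x :: real
  assumes "0 \<le> x"
  shows "x * (1 - x\<^sup>2 / 6) \<le> sin x"
proof -
  have "\<bar>sin x - x\<bar> \<le> x ^ 3 / 6"
    using Maclaurin_sin_bound[of x 3] assms
    by (simp add: eval_nat_numeral sin_coeff_def field_simps)
  then have "x - x ^ 3 / 6 \<le> sin x"
    by linarith
  also have "x - x ^ 3 / 6 = x * (1 - x\<^sup>2 / 6)"
    by (simp add: right_diff_distrib power2_eq_square power3_eq_cube)
  finally show ?thesis .
qed

text \<open>By \<open>sin_ge_cubic\<close> the leading term loses a factor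
  \<open>(1 - x\<^sup>2 / 6)\<^sup>2\<close> at each \<open>x = pi * y / 2 ^ j\<close>. These losses
  are summable, so their product stays at least \<open>(1 / 9)\<^sup>2 = 1 / 81\<close>.\<close>

lemma riesz_density_rescale_ge:
  assumes "0 \<le> y" "y \<le> 1"
  shows "2 ^ m * riesz_scale m * y ^ (2 * m) / 81 \<le> riesz_density m (y / 2 ^ m)"
proof -
  \<comment> \<open>An explicit minorant of the partial products of
    \<open>1 - x\<^sup>2 / 6\<close>, decreasing from 1 to \<open>1/9\<close>. Its decrement is
    exactly the bound for \<open>x\<^sup>2 / 6\<close> obtained from \<open>pi * y \<le> 4\<close>;
    these decrements sum to \<open>8/9\<close>.\<close>
  define c :: "nat \<Rightarrow> real" where "c m = 1 - 8 / 9 * (1 - 1 / 4 ^ m)" for m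
  have c_ge: "1 / 9 \<le> c m" for m
    by (simp add: c_def field_simps)
  have c_le: "c m \<le> 1" for m
    by (simp add: c_def field_simps)
  have step: "c (Suc m) \<le> c m * (1 - (pi * y / 2 ^ Suc m)\<^sup>2 / 6)" for m
  proof -
    have "(pi * y)\<^sup>2 \<le> 4\<^sup>2"
      using assms pi_less_4 mult_mono[of pi 4 y 1] by (intro power_mono) auto
    then have "(pi * y / 2 ^ Suc m)\<^sup>2 / 6 \<le> 4\<^sup>2 / (2 ^ Suc m)\<^sup>2 / 6"
      unfolding power_divide by (intro divide_right_mono) auto
    also have "\<dots> = c m - c (Suc m)"
      by (simp add: c_def power_mult_distrib power2_eq_square field_simps
          flip: power_mult_distrib)
    finally have *: "(pi * y / 2 ^ Suc m)\<^sup>2 / 6 \<le> c m - c (Suc m)" .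
    have "c m * ((pi * y / 2 ^ Suc m)\<^sup>2 / 6) \<le> 1 * ((pi * y / 2 ^ Suc m)\<^sup>2 / 6)"
      using c_le by (intro mult_right_mono) auto
    with * show ?thesis
      by (simp add: right_diff_distrib)
  qed
  have "(c m)\<^sup>2 * (2 ^ m * riesz_scale m * y ^ (2 * m)) \<le> riesz_density m (y / 2 ^ m)"
  proof (induction m)
    case 0
    then show ?case by (simp add: riesz_density_def riesz_scale_def c_def)
  next
    case (Suc m)
    define x where "x = pi * y / 2 ^ Suc m"
    have x: "0 \<le> x"
      using assms by (simp add: x_def)
    have cx: "c (Suc m) \<le> c m * (1 - x\<^sup>2 / 6)"
      using step by (simp add: x_def)
    \<comment> \<open>Squaring the sine bound requires a nonnegative left side; the sign is read off
      from \<open>c (Suc m)\<close> and \<open>c m\<close> being positive.\<close>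
    have "0 < c m * (1 - x\<^sup>2 / 6)"
      using c_ge[of "Suc m"] cx by linarith
    then have pos: "0 < 1 - x\<^sup>2 / 6"
      using c_ge[of m] by (auto simp: zero_less_mult_iff)
    have sin2: "(x * (1 - x\<^sup>2 / 6))\<^sup>2 \<le> (sin x)\<^sup>2"
      using x pos sin_ge_cubic[OF x] by (intro power_mono) auto
    have "(c (Suc m))\<^sup>2 * (2 ^ Suc m * riesz_scale (Suc m) * y ^ (2 * Suc m)) \<le>
        (c m * (1 - x\<^sup>2 / 6))\<^sup>2 * (2 ^ Suc m * riesz_scale (Suc m) * y ^ (2 * Suc m))"
      using cx c_ge[of "Suc m"] riesz_scale_pos[of "Suc m"] assms
      by (intro mult_right_mono power_mono) auto
    also have "2 ^ Suc m * riesz_scale (Suc m) * y ^ (2 * Suc m) =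
        2 ^ m * (2 * riesz_scale (Suc m)) * y ^ (2 * Suc m)"
      by simp
    also have "(c m * (1 - x\<^sup>2 / 6))\<^sup>2 * \<dots> =
        2 * (x * (1 - x\<^sup>2 / 6))\<^sup>2 * ((c m)\<^sup>2 * (2 ^ m * riesz_scale m * y ^ (2 * m)))"
      unfolding riesz_scale_Suc x_def
      by (simp add: power_mult_distrib power_divide power_add power2_eq_square ac_simps)
    also have "\<dots> \<le> 2 * (sin x)\<^sup>2 * riesz_density m (y / 2 ^ m)"
      using sin2 riesz_scale_pos[of m] assms by (intro mult_mono Suc.IH) auto
    also have "\<dots> = riesz_density (Suc m) (y / 2 ^ Suc m)"
      unfolding x_def riesz_density_Suc_rescale ..
    finally show ?case by simp
  qed
  moreover have "(1 / 9)\<^sup>2 * (2 ^ m * riesz_scale m * y ^ (2 * m)) \<le>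
      (c m)\<^sup>2 * (2 ^ m * riesz_scale m * y ^ (2 * m))"
    using c_ge[of m] riesz_scale_pos[of m] assms by (intro mult_right_mono power_mono) auto
  ultimately have "(1 / 9)\<^sup>2 * (2 ^ m * riesz_scale m * y ^ (2 * m)) \<le> riesz_density m (y / 2 ^ m)"
    by (rule order_trans[rotated])
  then show ?thesis
    by (simp add: power2_eq_square)
qed

section \<open>Mass of \<open>[0, t / 2 ^ m]\<close> under the partial products\<close>

lemma integral_riesz_density_le:
  assumes "0 \<le> t" "t \<le> 1"
  shows "integral {0..t / 2 ^ m} (riesz_density (m + n)) \<le> riesz_scale m * t ^ (2 * m)"
proof -
  let ?C = "2 ^ m * riesz_scale m * t ^ (2 * m)"
  have C: "0 \<le> ?C"
    using assms riesz_scale_pos[of m] by simp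
  have "riesz_density m (y / 2 ^ m) \<le> ?C" if "y \<in> {0..t}" for y
  proof -
    have "2 ^ m * riesz_scale m * y ^ (2 * m) \<le> ?C"
      using that riesz_scale_pos[of m] by (intro mult_left_mono power_mono) auto
    with riesz_density_rescale_le[of m y] show ?thesis by linarith
  qed
  then have "integral {0..t / 2 ^ m} (riesz_density (m + n)) \<le>
      ?C * integral {0..t} (riesz_density n) / 2 ^ m"
    using integral_riesz_density_rescale_le[of 0 t m ?C n] by simp
  also have "\<dots> \<le> ?C * integral {0..1} (riesz_density n) / 2 ^ m"
    using assms C by (intro divide_right_mono mult_left_mono integral_riesz_density_mono) auto
  finally show ?thesis
    by (simp add: integral_riesz_density_unit)
qed

text \<open>The weight is bounded below by its value at \<open>t / 2\<close>, whence
  \<open>4 ^ m\<close>. The constant is \<open>5184 = 81 * 64\<close>, from the sine losses and the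
  mass of \<open>[t/2, t]\<close>.\<close>

lemma integral_riesz_density_ge:
  assumes "1 / 2 \<le> t" "t \<le> 1"
  shows "riesz_scale m * t ^ (2 * m) / 4 ^ m / 5184 \<le>
           integral {0..t / 2 ^ m} (riesz_density (m + (n + 3)))"
proof -
  let ?C = "2 ^ m * riesz_scale m * (t / 2) ^ (2 * m) / 81"
  have C: "0 \<le> ?C"
    using assms riesz_scale_pos[of m] by simp
  have "?C \<le> riesz_density m (y / 2 ^ m)" if "y \<in> {t/2..t}" for y
  proof -
    have "?C \<le> 2 ^ m * riesz_scale m * y ^ (2 * m) / 81"
      using that assms riesz_scale_pos[of m]
      by (intro divide_right_mono mult_left_mono power_mono) auto
    also have "\<dots> \<le> riesz_density m (y / 2 ^ m)"
      using assms that by (intro riesz_density_rescale_ge) auto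
    finally show ?thesis .
  qed
  then have "?C * integral {t/2..t} (riesz_density (n + 3)) / 2 ^ m \<le>
      integral {t / 2 / 2 ^ m..t / 2 ^ m} (riesz_density (m + (n + 3)))"
    by (intro integral_riesz_density_rescale_ge) auto
  also have "\<dots> \<le> integral {0..t / 2 ^ m} (riesz_density (m + (n + 3)))"
    using assms by (intro integral_riesz_density_mono) auto
  finally have "?C * integral {t/2..t} (riesz_density (n + 3)) / 2 ^ m \<le>
      integral {0..t / 2 ^ m} (riesz_density (m + (n + 3)))" .
  moreover have "?C * (1 / 64) / 2 ^ m \<le> ?C * integral {t/2..t} (riesz_density (n + 3)) / 2 ^ m"
    using C assms integral_riesz_density_upper_half
    by (intro divide_right_mono mult_left_mono) auto
  ultimately show ?thesis
    by (simp add: power_divide power_mult)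
qed

section \<open>The asymptotic profile\<close>

text \<open>The common shape of both bounds: the upper one is a multiple of it, the lower one has an
  extra factor \<open>k\<^sup>2\<close>.\<close>

definition tm_profile :: "real \<Rightarrow> real" where
  "tm_profile k = k powr tm_alpha * exp (- ((ln k)\<^sup>2 / ln 2))"

lemma tm_profile_pos: "0 < k \<Longrightarrow> 0 < tm_profile k"
  by (simp add: tm_profile_def)

lemma isCont_tm_profile: "0 < k \<Longrightarrow> isCont tm_profile k"
  unfolding tm_profile_def by (intro continuous_intros) auto

lemma tm_alpha_ln_2: "tm_alpha * ln 2 = - ln (pi\<^sup>2 / 2)"
  by (simp add: tm_alpha_def)

lemma pi_square_half_gt_1: "1 < pi\<^sup>2 / 2"
  using mult_strict_mono[of 2 pi 2 pi] pi_gt3 by (simp add: power2_eq_square)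

text \<open>Expanding the square in \<open>ln t - m * ln 2\<close> yields the powers
  \<open>2 ^ (m\<^sup>2)\<close> and \<open>t ^ (2 * m)\<close>. The value of
  \<open>tm_alpha\<close> is the one for which the remaining term linear in \<open>m\<close> gives
  \<open>(pi\<^sup>2 / 2) ^ m\<close>; what is left depends on \<open>t\<close> alone.\<close>

lemma tm_profile_dyadic:
  assumes "0 < t"
  shows "tm_profile (t / 2 ^ m) =
           riesz_scale m * t ^ (2 * m) * exp (tm_alpha * ln t - (ln t)\<^sup>2 / ln 2)"
proof -
  have "tm_profile (t / 2 ^ m) = exp (tm_alpha * ln (t / 2 ^ m) - (ln (t / 2 ^ m))\<^sup>2 / ln 2)"
    using assms by (simp add: tm_profile_def powr_def flip: exp_add)
  also have "ln (t / 2 ^ m) = ln t - m * ln 2"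
    using assms by (simp add: ln_div ln_realpow)
  also have "tm_alpha * (ln t - m * ln 2) - (ln t - m * ln 2)\<^sup>2 / ln 2 =
      m * ln (pi\<^sup>2 / 2) - real (m\<^sup>2) * ln 2 + real (2 * m) * ln t
      + (tm_alpha * ln t - (ln t)\<^sup>2 / ln 2)"
    using arg_cong[OF tm_alpha_ln_2, of "\<lambda>z. real m * z"]
    by (simp add: power2_eq_square field_simps)
  also have "exp \<dots> = exp (m * ln (pi\<^sup>2 / 2)) / exp (real (m\<^sup>2) * ln 2) * exp (real (2 * m) * ln t)
      * exp (tm_alpha * ln t - (ln t)\<^sup>2 / ln 2)"
    by (simp only: exp_add exp_diff)
  also have "\<dots> = riesz_scale m * t ^ (2 * m) * exp (tm_alpha * ln t - (ln t)\<^sup>2 / ln 2)"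
    using assms pi_square_half_gt_1 by (simp only: exp_of_nat_mult riesz_scale_def) simp
  finally show ?thesis .
qed

text \<open>For such \<open>t\<close> the leftover exponent lies between \<open>- ln 2\<close> and
  \<open>ln (pi\<^sup>2 / 2)\<close>, since \<open>tm_alpha \<le> 0\<close> and
  \<open>- ln 2 \<le> ln t \<le> 0\<close>.\<close>

lemma tm_profile_bounds:
  assumes "1 / 2 \<le> t" "t \<le> 1"
  shows "riesz_scale m * t ^ (2 * m) \<le> 2 * tm_profile (t / 2 ^ m)"
    and "tm_profile (t / 2 ^ m) \<le> pi\<^sup>2 / 2 * (riesz_scale m * t ^ (2 * m))"
proof -
  have t: "0 < t"
    using assms by simp
  define e where "e = tm_alpha * ln t - (ln t)\<^sup>2 / ln 2"
  define E where "E = riesz_scale m * t ^ (2 * m)"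
  have E: "0 < E"
    using t riesz_scale_pos by (simp add: E_def)
  have profile: "tm_profile (t / 2 ^ m) = E * exp e"
    using tm_profile_dyadic[OF t] by (simp add: E_def e_def)
  have ln_t: "- ln 2 \<le> ln t" "ln t \<le> 0"
    using assms t ln_mono[of "1/2" t] by (auto simp: ln_div)
  have alpha: "tm_alpha \<le> 0"
    using pi_square_half_gt_1 ln_gt_zero[of "pi\<^sup>2 / 2"] by (simp add: tm_alpha_def)
  have "(ln t)\<^sup>2 \<le> (ln 2)\<^sup>2"
    using ln_t by (simp flip: abs_le_square_iff)
  then have "(ln t)\<^sup>2 / ln 2 \<le> ln 2"
    by (simp add: divide_le_eq power2_eq_square)
  moreover have "0 \<le> tm_alpha * ln t"
    using alpha ln_t by (intro mult_nonpos_nonpos)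
  ultimately have "- ln 2 \<le> e"
    by (simp add: e_def)
  then have "exp (- ln 2) \<le> exp e"
    by simp
  then have "1 / 2 \<le> exp e"
    by (simp add: exp_minus)
  then have "E * (1 / 2) \<le> E * exp e"
    using E by (intro mult_left_mono) auto
  then show "riesz_scale m * t ^ (2 * m) \<le> 2 * tm_profile (t / 2 ^ m)"
    by (simp add: profile flip: E_def)
  have "tm_alpha * ln t \<le> tm_alpha * (- ln 2)"
    using alpha ln_t by (intro mult_left_mono_neg) auto
  then have "e \<le> ln (pi\<^sup>2 / 2)"
    using tm_alpha_ln_2 unfolding e_def
    by (smt (verit) divide_nonneg_pos ln_gt_zero mult_minus_right zero_le_power2)
  then have "exp e \<le> exp (ln (pi\<^sup>2 / 2))"
    by (simp only: exp_le_cancel_iff)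
  also have "\<dots> = pi\<^sup>2 / 2"
    using pi_square_half_gt_1 by (intro exp_ln) linarith
  finally have "exp e \<le> pi\<^sup>2 / 2" .
  then have "E * exp e \<le> E * (pi\<^sup>2 / 2)"
    using E by (intro mult_left_mono) auto
  then show "tm_profile (t / 2 ^ m) \<le> pi\<^sup>2 / 2 * (riesz_scale m * t ^ (2 * m))"
    unfolding profile E_def[symmetric] by (simp only: mult.commute)
qed

lemma dyadic_scale_obtains:
  fixes k :: real
  assumes "0 < k" "k \<le> 1"
  obtains m :: nat and t :: real where "1 / 2 \<le> t" "t \<le> 1" "k = t / 2 ^ m"
proof
  \<comment> \<open>As \<open>k \<le> 1\<close>, the floor is nonnegative and \<open>nat\<close>
    truncates nothing.\<close>
  define m where "m = nat \<lfloor>- log 2 k\<rfloor>"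
  have "log 2 k \<le> 0"
    using assms by simp
  then have m: "real m \<le> - log 2 k" "- log 2 k \<le> m + 1"
    unfolding m_def by linarith+
  have k: "k = 2 powr (log 2 k)"
    using assms by simp
  have t: "k * 2 ^ m = 2 powr (log 2 k + m)"
    using k by (simp add: powr_add powr_realpow)
  have "2 powr (-1) \<le> 2 powr (log 2 k + m)"
    using m by (intro powr_mono) auto
  then show "1 / 2 \<le> k * 2 ^ m"
    unfolding t by (simp add: powr_minus)
  have "2 powr (log 2 k + m) \<le> 2 powr 0"
    using m by (intro powr_mono) auto
  then show "k * 2 ^ m \<le> 1"
    unfolding t by simp
  show "k = k * 2 ^ m / 2 ^ m"
    by simp
qed

lemma eventually_integral_riesz_density_bounds:
  assumes "0 < k" "k \<le> 1"
  shows "\<forall>\<^sub>F n in sequentially.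
    k\<^sup>2 * tm_profile k / (2592 * pi\<^sup>2) \<le> integral {0..k} (riesz_density n) \<and>
    integral {0..k} (riesz_density n) \<le> 2 * tm_profile k"
proof -
  obtain m t where t: "1 / 2 \<le> t" "t \<le> 1" and k: "k = t / 2 ^ m"
    using dyadic_scale_obtains[OF assms] .
  define E where "E = riesz_scale m * t ^ (2 * m)"
  have E: "0 \<le> E"
    using t riesz_scale_pos[of m] by (simp add: E_def)
  \<comment> \<open>Here \<open>k\<^sup>2 \<le> 1 / 4 ^ m\<close> absorbs the loss
    \<open>4 ^ m\<close>, and \<open>2592 * pi\<^sup>2 = 5184 * (pi\<^sup>2 / 2)\<close>.\<close>
  have lower: "k\<^sup>2 * tm_profile k / (2592 * pi\<^sup>2) \<le> E / 4 ^ m / 5184"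
  proof -
    have "k\<^sup>2 \<le> 1 / 4 ^ m"
    proof -
      have "k\<^sup>2 \<le> (1 / 2 ^ m)\<^sup>2"
        unfolding k using t by (intro power_mono divide_right_mono) auto
      then show ?thesis
        by (simp add: power_divide power2_eq_square flip: power_mult_distrib)
    qed
    moreover have "tm_profile k \<le> pi\<^sup>2 / 2 * E"
      unfolding k E_def by (rule tm_profile_bounds(2)[OF t])
    ultimately have "k\<^sup>2 * tm_profile k \<le> 1 / 4 ^ m * (pi\<^sup>2 / 2 * E)"
      using tm_profile_pos[OF assms(1)] by (intro mult_mono) auto
    then have "k\<^sup>2 * tm_profile k / (2592 * pi\<^sup>2) \<le> 1 / 4 ^ m * (pi\<^sup>2 / 2 * E) / (2592 * pi\<^sup>2)"
      by (intro divide_right_mono) auto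
    then show ?thesis by simp
  qed
  have upper: "E \<le> 2 * tm_profile k"
    unfolding k E_def by (rule tm_profile_bounds(1)[OF t])
  show ?thesis
    \<comment> \<open>The threshold consists of \<open>m\<close> factors for the scale of
      \<open>k\<close> and three for the mass of \<open>[t/2, t]\<close>.\<close>
    using eventually_ge_at_top[of "m + 3"]
  proof eventually_elim
    case (elim n)
    then obtain i where n: "n = m + (i + 3)"
      by (metis add.assoc add.commute le_Suc_ex)
    have "E / 4 ^ m / 5184 \<le> integral {0..k} (riesz_density n)"
      unfolding n k E_def by (rule integral_riesz_density_ge[OF t])
    moreover have "integral {0..k} (riesz_density n) \<le> E"
      unfolding n k E_def using t by (intro integral_riesz_density_le) auto
    ultimately show ?case
      using lower upper by linarith
  qed
qed

section \<open>Passage to the limit\<close>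

lemma cdf_riesz_measure:
  assumes "x < 1"
  shows "cdf (riesz_measure n) x = integral {0..x} (riesz_density n)"
proof -
  have [measurable]: "riesz_density n \<in> borel_measurable borel"
    by (intro borel_measurable_continuous_onI continuous_intros)
  have "emeasure (riesz_measure n) {..x} =
      (\<integral>\<^sup>+ y. ennreal (riesz_density n y * indicator {0..<1} y) * indicator {..x} y \<partial>lborel)"
    unfolding riesz_measure_def by (subst emeasure_density) auto
  \<comment> \<open>For \<open>x < 1\<close> the cut-off at 1 is invisible; for negative
    \<open>x\<close> both sides vanish.\<close>
  also have "\<dots> = (\<integral>\<^sup>+ y. ennreal (riesz_density n y) * indicator {0..x} y \<partial>lborel)"
    using assms by (intro nn_integral_cong) (auto simp: indicator_def)
  also have "\<dots> = ennreal (integral {0..x} (riesz_density n))"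
    using riesz_density_integrable
    by (intro nn_integral_has_integral_lebesgue') (auto simp: riesz_density_nonneg)
  finally show ?thesis
    by (simp add: cdf_def measure_def integral_nonneg riesz_density_integrable riesz_density_nonneg)
qed

text \<open>A monotone function has only countably many discontinuities, so continuity points of the
  limit, where weak convergence is pointwise, accumulate at \<open>x\<close> from the right.\<close>

lemma frequently_weak_conv_m_cdf:
  assumes "real_distribution \<mu>" "weak_conv_m M \<mu>"
  shows "\<exists>\<^sub>F y in at_right x. (\<lambda>n. cdf (M n) y) \<longlonglongrightarrow> cdf \<mu> y"
proof -
  interpret real_distribution \<mu> by fact
  have "mono (cdf \<mu>)"
    by (simp add: mono_def cdf_nondecreasing)
  then have "countable {y. \<not> isCont (cdf \<mu>) y}"
    by (rule mono_ctble_discont)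
  then have "\<exists>y\<in>{x<..<d}. isCont (cdf \<mu>) y" if "x < d" for d
    using open_minus_countable[of "{y. \<not> isCont (cdf \<mu>) y}" "{x<..<d}"] that by auto
  then have "\<exists>\<^sub>F y in at_right x. isCont (cdf \<mu>) y"
    unfolding frequently_def eventually_at_right_field by (meson greaterThanLessThan_iff)
  then show ?thesis
    by (rule frequently_elim1) (use assms(2) in \<open>auto simp: weak_conv_m_def weak_conv_def\<close>)
qed

text \<open>The limit distribution function need not be known to be continuous at \<open>x\<close>: it is
  approached along continuity points from the right.\<close>

lemma weak_conv_m_cdf_bounds:
  assumes \<mu>: "real_distribution \<mu>" and conv: "weak_conv_m M \<mu>"
    and cont: "continuous (at_right x) g" "continuous (at_right x) h"
    and bounds: "\<forall>\<^sub>F y in at_right x. \<forall>\<^sub>F n in sequentially. g y \<le> cdf (M n) y \<and> cdf (M n) y \<le> h y"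
  shows "g x \<le> cdf \<mu> x" "cdf \<mu> x \<le> h x"
proof -
  interpret real_distribution \<mu> by fact
  have F: "(cdf \<mu> \<longlongrightarrow> cdf \<mu> x) (at_right x)"
    using cdf_is_right_cont by (simp add: continuous_within)
  have freq: "\<exists>\<^sub>F y in at_right x. g y \<le> cdf \<mu> y \<and> cdf \<mu> y \<le> h y"
  proof (rule frequently_rev_mp[OF frequently_weak_conv_m_cdf[OF \<mu> conv]])
    show "\<forall>\<^sub>F y in at_right x. (\<lambda>n. cdf (M n) y) \<longlonglongrightarrow> cdf \<mu> y \<longrightarrow>
        g y \<le> cdf \<mu> y \<and> cdf \<mu> y \<le> h y"
      using bounds
    proof eventually_elim
      case (elim y)
      then have "\<forall>\<^sub>F n in sequentially. g y \<le> cdf (M n) y"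
        "\<forall>\<^sub>F n in sequentially. cdf (M n) y \<le> h y"
        by (auto elim: eventually_mono)
      then show ?case
        by (auto intro: tendsto_lowerbound tendsto_upperbound)
    qed
  qed
  show "g x \<le> cdf \<mu> x"
  \<comment> \<open>By right continuity a strict failure at \<open>x\<close> would persist on a
    right neighbourhood, contradicting \<open>freq\<close>.\<close>
  proof (rule ccontr)
    assume "\<not> g x \<le> cdf \<mu> x"
    moreover have "((\<lambda>y. g y - cdf \<mu> y) \<longlongrightarrow> g x - cdf \<mu> x) (at_right x)"
      using cont F by (intro tendsto_intros) (simp_all add: continuous_within)
    ultimately have "\<forall>\<^sub>F y in at_right x. 0 < g y - cdf \<mu> y"
      by (intro order_tendstoD) auto
    then have "\<forall>\<^sub>F y in at_right x. \<not> (g y \<le> cdf \<mu> y \<and> cdf \<mu> y \<le> h y)"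
      by eventually_elim auto
    with freq show False by (simp add: frequently_def)
  qed
  show "cdf \<mu> x \<le> h x"
  proof (rule ccontr)
    assume "\<not> cdf \<mu> x \<le> h x"
    moreover have "((\<lambda>y. cdf \<mu> y - h y) \<longlongrightarrow> cdf \<mu> x - h x) (at_right x)"
      using cont F by (intro tendsto_intros) (simp_all add: continuous_within)
    ultimately have "\<forall>\<^sub>F y in at_right x. 0 < cdf \<mu> y - h y"
      by (intro order_tendstoD) auto
    then have "\<forall>\<^sub>F y in at_right x. \<not> (g y \<le> cdf \<mu> y \<and> cdf \<mu> y \<le> h y)"
      by eventually_elim auto
    with freq show False by (simp add: frequently_def)
  qed
qed

text \<open>The point is that the limit has no mass on the negative axis: its distribution function
  vanishes there, and so does its left limit at 0, which is the mass of
  \<open>{..<0}\<close>.\<close>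

lemma measure_thue_morse_eq_cdf:
  assumes "is_thue_morse_measure \<mu>"
  shows "measure \<mu> {0..k} = cdf \<mu> k"
proof -
  from assms have \<mu>: "real_distribution \<mu>" and conv: "weak_conv_m riesz_measure \<mu>"
    by (auto simp: is_thue_morse_measure_def)
  interpret real_distribution \<mu> by fact
  have zero: "cdf \<mu> y = 0" if "y < 0" for y
  proof -
    have "\<forall>\<^sub>F z in at_right y. z < 0"
      using that by (auto simp: eventually_at_right_field)
    then have "\<forall>\<^sub>F z in at_right y. \<forall>\<^sub>F n in sequentially.
        0 \<le> cdf (riesz_measure n) z \<and> cdf (riesz_measure n) z \<le> 0"
      by eventually_elim (simp add: cdf_riesz_measure)
    from weak_conv_m_cdf_bounds[OF \<mu> conv _ _ this] show ?thesis
      by simp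
  qed
  have "measure \<mu> {..<0} = 0"
  proof (rule tendsto_unique[OF _ cdf_at_left])
    have "\<forall>\<^sub>F y in at_left 0. cdf \<mu> y = 0"
      by (auto simp: eventually_at_left_field zero intro: exI[of _ "-1"])
    then show "(cdf \<mu> \<longlongrightarrow> 0) (at_left 0)"
      by (rule tendsto_eventually)
  qed auto
  show ?thesis
  proof (cases "k < 0")
    case True
    then show ?thesis by (simp add: zero)
  next
    case False
    then have "{..k} = {..<0} \<union> {0..k}"
      by auto
    then have "cdf \<mu> k = measure \<mu> {..<0} + measure \<mu> {0..k}"
      unfolding cdf_def by (auto intro: finite_measure_Union)
    with \<open>measure \<mu> {..<0} = 0\<close> show ?thesis by simp
  qed
qed

theorem theorem5p2:
  fixes \<mu> :: "real measure" and F :: "real \<Rightarrow> real"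
  assumes "is_thue_morse_measure \<mu>"
    and "\<And>k. F k = measure \<mu> {0..k}"
  shows "\<exists>c1 c2 k0 :: real. c1 > 0 \<and> c2 > 0 \<and> k0 > 0 \<and>
    (\<forall>k. 0 < k \<and> k \<le> k0 \<longrightarrow>
       c1 * k powr (2 + tm_alpha) * exp (- ((ln k)\<^sup>2 / ln 2)) \<le> F k \<and>
       F k \<le> c2 * k powr tm_alpha * exp (- ((ln k)\<^sup>2 / ln 2)))"
proof (intro exI conjI allI impI)
  let ?c = "1 / (2592 * pi\<^sup>2) :: real"
  show "0 < ?c" "0 < (2 :: real)" "0 < (1 / 2 :: real)"
    by auto
  fix k :: real
  assume k: "0 < k \<and> k \<le> 1 / 2"
  from assms(1) have \<mu>: "real_distribution \<mu>" and conv: "weak_conv_m riesz_measure \<mu>"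
    by (auto simp: is_thue_morse_measure_def)
  let ?g = "\<lambda>k. k\<^sup>2 * tm_profile k / (2592 * pi\<^sup>2)" and ?h = "\<lambda>k. 2 * tm_profile k"
  have cont: "continuous (at_right k) tm_profile"
    using isCont_tm_profile k by (blast intro: continuous_at_imp_continuous_at_within)
  \<comment> \<open>The choice \<open>1/2\<close> for \<open>k0\<close> leaves room to the right of
    \<open>k\<close> below 1, where \<open>cdf_riesz_measure\<close> applies.\<close>
  have "\<forall>\<^sub>F y in at_right k. y \<in> {k<..<1}"
    using k by (intro eventually_at_right_real) auto
  then have "\<forall>\<^sub>F y in at_right k. \<forall>\<^sub>F n in sequentially.
      ?g y \<le> cdf (riesz_measure n) y \<and> cdf (riesz_measure n) y \<le> ?h y"
  proof eventually_elim
    case (elim y)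
    then show ?case
      using k eventually_integral_riesz_density_bounds[of y] by (simp add: cdf_riesz_measure)
  qed
  then have "?g k \<le> cdf \<mu> k" "cdf \<mu> k \<le> ?h k"
    using cont by (auto intro!: weak_conv_m_cdf_bounds[OF \<mu> conv, of k ?g ?h] continuous_intros)
  moreover have "cdf \<mu> k = F k"
    by (simp add: assms(2) measure_thue_morse_eq_cdf[OF assms(1)])
  moreover have "k powr (2 + tm_alpha) = k\<^sup>2 * k powr tm_alpha"
    using k by (simp add: powr_add)
  ultimately show "?c * k powr (2 + tm_alpha) * exp (- ((ln k)\<^sup>2 / ln 2)) \<le> F k"
    "F k \<le> 2 * k powr tm_alpha * exp (- ((ln k)\<^sup>2 / ln 2))"
    by (simp_all add: tm_profile_def mult.assoc)
qed

end
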